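(* Let $E$ be a semi-Montel space over $\mathbb{K}$, let the linear subspace $G\subset E'$ determine boundedness, $\Omega\subset\mathbb{R}^{d}$ open and $k\in\mathbb{N}$. If $f\colon\Omega\to E$ is such that $e'\circ f\in\mathcal{C}^{k}(\Omega)$ for all $e'\in G$, then $f\in\mathcal{C}^{k}(\Omega,E)$.
   Context: $\mathbb{K}=\mathbb{R}$ or $\mathbb{C}$. A semi-Montel space is a (non-trivial) locally convex Hausdorff space over $\mathbb{K}$ in which every bounded set is relatively compact. $G\subset E'$ determines boundedness if every $\sigma(E,G)$-bounded subset of $E$ is bounded in $E$. $\mathcal{C}^{k}(\Omega,E)$ is the space of $k$-times continuously partially differentiable functions $f\colon\Omega\to E$ (partial derivatives being limits in $E$ of difference quotients); $\mathcal{C}^{k}(\Omega):=\mathcal{C}^{k}(\Omega,\mathbb{K})$. *)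

theory Defs
  imports "HOL-Analysis.Analysis"
begin

text \<open>
  The scalar field is a type of the following class, whose members are, up to isometric isomorphism,
  exactly the real and the complex numbers. (The norm of a \<^class>\<open>real_normed_field\<close> is
  multiplicative, hence it is the usual absolute value.)
\<close>

class real_or_complex = real_normed_field +
  assumes real_or_complex:
    "(\<forall>z. \<exists>a. z = a *\<^sub>R 1) \<or>
     (\<exists>j. j * j = - 1 \<and> (\<forall>z. \<exists>a b. z = a *\<^sub>R 1 + b *\<^sub>R j))"

instance real :: real_or_complex
  by standard simp

instance complex :: real_or_complex
proof
  have "\<exists>a b. z = a *\<^sub>R 1 + b *\<^sub>R \<i>" for z :: complex
    by (intro exI[of _ "Re z"] exI[of _ "Im z"]) (simp add: complex_eq_iff)
  then show "(\<forall>z::complex. \<exists>a. z = a *\<^sub>R 1) \<or>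
    (\<exists>j::complex. j * j = - 1 \<and> (\<forall>z. \<exists>a b. z = a *\<^sub>R 1 + b *\<^sub>R j))"
    using i_squared by blast
qed

text \<open>
  The carrier, the addition and the Hausdorff topology of a space \<open>E\<close> are those of its type;
  the scalar multiplication is an explicit parameter.
\<close>

definition convex_wrt :: "('k::real_normed_field \<Rightarrow> 'e::ab_group_add \<Rightarrow> 'e) \<Rightarrow> 'e set \<Rightarrow> bool" where
  "convex_wrt smul V \<longleftrightarrow>
     (\<forall>x\<in>V. \<forall>y\<in>V. \<forall>t::real. 0 \<le> t \<longrightarrow> t \<le> 1 \<longrightarrow>
        smul (of_real (1 - t)) x + smul (of_real t) y \<in> V)"

locale locally_convex_hausdorff_space = vector_space smul
  for smul :: "'k::real_or_complex \<Rightarrow> 'e::{topological_ab_group_add, t2_space} \<Rightarrow> 'e" +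
  assumes continuous_smul: "continuous_on UNIV (\<lambda>(c, x). smul c x)"
    and convex_neighbourhoods:
      "open U \<Longrightarrow> 0 \<in> U \<Longrightarrow> \<exists>V. open V \<and> 0 \<in> V \<and> convex_wrt smul V \<and> V \<subseteq> U"
    and nontrivial: "\<exists>x::'e. x \<noteq> 0"

text \<open>Boundedness with respect to a vector topology \<open>T\<close>: being absorbed by every zero neighbourhood.\<close>

definition vector_bounded ::
    "('k::real_normed_field \<Rightarrow> 'e::ab_group_add \<Rightarrow> 'e) \<Rightarrow> 'e topology \<Rightarrow> 'e set \<Rightarrow> bool" where
  "vector_bounded smul T B \<longleftrightarrow>
     (\<forall>U. openin T U \<and> 0 \<in> U \<longrightarrow> (\<exists>r>0. \<forall>c. r \<le> norm c \<longrightarrow> B \<subseteq> smul c ` U))"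

locale semi_Montel_space = locally_convex_hausdorff_space smul
  for smul :: "'k::real_or_complex \<Rightarrow> 'e::{topological_ab_group_add, t2_space} \<Rightarrow> 'e" +
  assumes bounded_relatively_compact: "vector_bounded smul euclidean B \<Longrightarrow> compact (closure B)"

definition topological_dual ::
    "('k::real_normed_field \<Rightarrow> 'e::{ab_group_add, topological_space} \<Rightarrow> 'e) \<Rightarrow> ('e \<Rightarrow> 'k) set" where
  "topological_dual smul = {\<phi>. Vector_Spaces.linear smul (*) \<phi> \<and> continuous_on UNIV \<phi>}"

definition linear_subspace_of ::
    "('e \<Rightarrow> 'k::real_normed_field) set \<Rightarrow> ('e \<Rightarrow> 'k) set \<Rightarrow> bool" where
  "linear_subspace_of G F \<longleftrightarrow>
     G \<subseteq> F \<and> (\<lambda>x. 0) \<in> G \<and>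
     (\<forall>\<phi>\<in>G. \<forall>\<psi>\<in>G. (\<lambda>x. \<phi> x + \<psi> x) \<in> G) \<and>
     (\<forall>c. \<forall>\<phi>\<in>G. (\<lambda>x. c * \<phi> x) \<in> G)"

text \<open>The weak topology \<open>\<sigma>(E,G)\<close>, i.e. the initial topology induced by the functions in \<open>G\<close>.\<close>

definition weak_topology :: "('e \<Rightarrow> 'k::topological_space) set \<Rightarrow> 'e topology" where
  "weak_topology G = topology_generated_by {\<phi> -` U | \<phi> U. \<phi> \<in> G \<and> open U}"

definition determines_boundedness ::
    "('k::real_normed_field \<Rightarrow> 'e::{ab_group_add, topological_space} \<Rightarrow> 'e) \<Rightarrow> ('e \<Rightarrow> 'k) set \<Rightarrow> bool" where
  "determines_boundedness smul G \<longleftrightarrow>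
     (\<forall>B. vector_bounded smul (weak_topology G) B \<longrightarrow> vector_bounded smul euclidean B)"

definition has_partial_derivative ::
    "('k::real_normed_field \<Rightarrow> 'e::{ab_group_add, topological_space} \<Rightarrow> 'e) \<Rightarrow>
     (real ^ 'd \<Rightarrow> 'e) \<Rightarrow> 'd \<Rightarrow> 'e \<Rightarrow> real ^ 'd \<Rightarrow> bool" where
  "has_partial_derivative smul f i l x \<longleftrightarrow>
     ((\<lambda>h::real. smul (of_real (1 / h)) (f (x + h *\<^sub>R axis i 1) - f x)) \<longlongrightarrow> l) (at 0)"

text \<open>
  A function on \<open>\<Omega>\<close> is represented by a total function; for open \<open>\<Omega>\<close> its values outside \<open>\<Omega>\<close> are
  irrelevant below. The recursion says that all iterated partial derivatives of order at most \<open>k\<close>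
  (including order zero) exist and are continuous on \<open>\<Omega>\<close>.
\<close>

primrec Ck_on ::
    "('k::real_normed_field \<Rightarrow> 'e::{ab_group_add, topological_space} \<Rightarrow> 'e) \<Rightarrow>
     nat \<Rightarrow> (real ^ 'd) set \<Rightarrow> (real ^ 'd \<Rightarrow> 'e) \<Rightarrow> bool" where
  "Ck_on smul 0 \<Omega> f \<longleftrightarrow> continuous_on \<Omega> f"
| "Ck_on smul (Suc k) \<Omega> f \<longleftrightarrow>
     continuous_on \<Omega> f \<and>
     (\<forall>i. \<exists>g. (\<forall>x\<in>\<Omega>. has_partial_derivative smul f i (g x) x) \<and> Ck_on smul k \<Omega> g)"

end

theory Submission
  imports Defs
begin

text \<open>
  \<open>G\<close> separates the points of \<open>E\<close>, because a line on which all of \<open>G\<close> vanishes is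
  \<open>\<sigma>(E,G)\<close>-bounded, hence bounded, which is impossible in a Hausdorff space. On a relatively
  compact set, a filter all of whose images under \<open>G\<close> converge has therefore exactly one cluster
  point, so it converges. Both values of \<open>f\<close> on a ball and difference quotients for
  small steps form \<open>\<sigma>(E,G)\<close>-bounded, hence relatively compact sets; this gives continuity and
  the existence of partial derivatives, and the claim follows by induction on \<open>k\<close>.
\<close>

section \<open>Zero neighbourhoods and bounded sets of the weak topology\<close>

text \<open>A generating set around 0 contains some \<open>{x. norm (\<phi> x) < e}\<close>.
  Containing a set of the claimed form survives finite intersections (join the finite sets, take the
  smaller radius) and arbitrary unions (one member around 0 suffices).\<close>

lemma openin_weak_topology_zero_nhd:
  fixes G :: "('e::zero \<Rightarrow> 'k::real_normed_field) set"
  assumes "openin (weak_topology G) U" "0 \<in> U" and G0: "\<And>\<phi>. \<phi> \<in> G \<Longrightarrow> \<phi> 0 = 0"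
  shows "\<exists>\<Phi> e. finite \<Phi> \<and> \<Phi> \<subseteq> G \<and> e > 0 \<and> {x. \<forall>\<phi>\<in>\<Phi>. norm (\<phi> x) < e} \<subseteq> U"
proof -
  have "generate_topology_on {\<phi> -` V | \<phi> V. \<phi> \<in> G \<and> open V} U"
    using assms(1) by (simp add: weak_topology_def openin_topology_generated_by_iff)
  then show ?thesis
    using assms(2)
  proof induction
    case Empty
    then show ?case by simp
  next
    case (Int U V)
    then obtain \<Phi> e \<Psi> e'
      where "finite \<Phi>" "\<Phi> \<subseteq> G" "e > 0" "{x. \<forall>\<phi>\<in>\<Phi>. norm (\<phi> x) < e} \<subseteq> U"
        and "finite \<Psi>" "\<Psi> \<subseteq> G" "e' > 0" "{x. \<forall>\<phi>\<in>\<Psi>. norm (\<phi> x) < e'} \<subseteq> V"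
      by auto
    then show ?case
      by (intro exI[of _ "\<Phi> \<union> \<Psi>"] exI[of _ "min e e'"]) auto
  next
    case (UN K)
    then obtain V where "V \<in> K" "0 \<in> V" by auto
    with UN.IH show ?case by (meson Union_upper subset_trans)
  next
    case (Basis U)
    then obtain \<phi> V where U: "U = \<phi> -` V" "\<phi> \<in> G" "open V" by auto
    then have "0 \<in> V" using Basis.prems G0[of \<phi>] by simp
    then obtain e where "e > 0" "ball 0 e \<subseteq> V"
      using U(3) open_contains_ball by blast
    with U show ?case
      by (intro exI[of _ "{\<phi>}"] exI[of _ e]) (auto simp: subset_iff)
  qed
qed

lemma topological_dual_module_hom: "\<phi> \<in> topological_dual smul \<Longrightarrow> module_hom smul (*) \<phi>"
  by (simp add: topological_dual_def Vector_Spaces.linear.axioms(3))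

text \<open>A weak zero neighbourhood controls only finitely many functionals, so one constant
  \<open>M\<close> bounds them all on \<open>B\<close>, and division by a scalar of large norm moves
  \<open>B\<close> into the neighbourhood.\<close>

lemma vector_bounded_weak_topologyI:
  fixes smul :: "'k::real_normed_field \<Rightarrow> 'e::{ab_group_add, topological_space} \<Rightarrow> 'e"
  assumes "vector_space smul" "G \<subseteq> topological_dual smul"
    and bdd: "\<And>\<phi>. \<phi> \<in> G \<Longrightarrow> bounded (\<phi> ` B)"
  shows "vector_bounded smul (weak_topology G) B"
  unfolding vector_bounded_def
proof (intro allI impI, elim conjE)
  interpret vector_space smul by fact
  fix U assume U: "openin (weak_topology G) U" "(0::'e) \<in> U"
  have hom: "module_hom smul (*) \<phi>" if "\<phi> \<in> G" for \<phi>
    using that assms(2) by (intro topological_dual_module_hom) auto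
  have "\<exists>\<Phi> e. finite \<Phi> \<and> \<Phi> \<subseteq> G \<and> e > 0 \<and> {x. \<forall>\<phi>\<in>\<Phi>. norm (\<phi> x) < e} \<subseteq> U"
    using U by (rule openin_weak_topology_zero_nhd) (rule module_hom.zero[OF hom])
  then obtain \<Phi> e
    where \<Phi>: "finite \<Phi>" "\<Phi> \<subseteq> G" "e > 0" "{x. \<forall>\<phi>\<in>\<Phi>. norm (\<phi> x) < e} \<subseteq> U"
    by blast
  have "bounded (\<Union>\<phi>\<in>\<Phi>. \<phi> ` B)"
    using \<Phi> bdd by (intro bounded_Union) auto
  then obtain M where M: "M > 0" "\<And>\<phi> x. \<phi> \<in> \<Phi> \<Longrightarrow> x \<in> B \<Longrightarrow> norm (\<phi> x) \<le> M"
    by (auto simp: bounded_pos)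
  \<comment> \<open>The factor 2 makes \<open>M / r\<close> equal to \<open>e / 2\<close>, which
    leaves room for the strict inequality.\<close>
  define r where "r = 2 * M / e"
  have "B \<subseteq> smul c ` U" if c: "r \<le> norm c" for c
  proof
    fix x assume x: "x \<in> B"
    have r: "r > 0" using M \<Phi> by (simp add: r_def)
    then have c0: "c \<noteq> 0" using c by auto
    have "norm (\<phi> (smul (inverse c) x)) < e" if "\<phi> \<in> \<Phi>" for \<phi>
    proof -
      have "norm (\<phi> (smul (inverse c) x)) = norm (\<phi> x) / norm c"
        using module_hom.scale[OF hom[of \<phi>]] that \<Phi>(2)
        by (simp add: subset_iff norm_mult norm_inverse divide_inverse)
      also have "\<dots> \<le> M / r"
        using M(2)[OF that x] M(1) c r by (intro frac_le) auto
      also have "\<dots> < e" using M(1) \<Phi>(3) by (simp add: r_def)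
      finally show ?thesis .
    qed
    then have "smul (inverse c) x \<in> U" using \<Phi>(4) by blast
    moreover have "x = smul c (smul (inverse c) x)" using c0 by simp
    ultimately show "x \<in> smul c ` U" by blast
  qed
  moreover have "r > 0" using M \<Phi> by (simp add: r_def)
  ultimately show "\<exists>r>0. \<forall>c. r \<le> norm c \<longrightarrow> B \<subseteq> smul c ` U" by blast
qed

section \<open>Convergence of filters in compact sets\<close>

text \<open>If \<open>q\<close> did not eventually stay in an open set around \<open>l\<close>, the
  part of its image filter outside that set would still cluster in \<open>K\<close>, necessarily at
  a point other than \<open>l\<close>.\<close>

lemma convergent_if_unique_cluster_point:
  fixes q :: "'a \<Rightarrow> 'e::topological_space"
  assumes "compact K" "\<forall>\<^sub>F h in F. q h \<in> K"
    and "\<And>l'. l' \<in> K \<Longrightarrow> inf (nhds l') (filtermap q F) \<noteq> bot \<Longrightarrow> l' = l"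
  shows "(q \<longlongrightarrow> l) F"
proof (rule topological_tendstoI, rule ccontr)
  fix U assume U: "open U" "l \<in> U" and nev: "\<not> (\<forall>\<^sub>F h in F. q h \<in> U)"
  \<comment> \<open>This filter is proper precisely because \<open>q h\<close> is not eventually in
    \<open>U\<close>; being finer than the image filter of \<open>q\<close>, it has only cluster
    points which that filter has too.\<close>
  define F' where "F' = inf (filtermap q F) (principal (- U))"
  have "F' \<noteq> bot"
    using nev by (auto simp: F'_def trivial_limit_def eventually_inf_principal eventually_filtermap)
  moreover have "\<forall>\<^sub>F y in F'. y \<in> K"
    using assms(2) by (auto simp: F'_def eventually_inf_principal eventually_filtermap elim: eventually_mono)
  ultimately obtain l' where l': "l' \<in> K" "inf (nhds l') F' \<noteq> bot"
    using assms(1) unfolding compact_filter by blast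
  have "inf (nhds l') F' \<le> inf (nhds l') (filtermap q F)"
    by (auto simp: F'_def intro: le_infI2)
  then have "l' = l" using assms(3) l' by (metis bot.extremum_uniqueI)
  then have "\<forall>\<^sub>F y in nhds l'. y \<in> U" using U eventually_nhds by blast
  moreover have "\<forall>\<^sub>F y in F'. y \<notin> U" by (simp add: F'_def eventually_inf_principal)
  ultimately have "\<forall>\<^sub>F y in inf (nhds l') F'. False"
    by (auto simp: eventually_inf)
  with l'(2) show False by (simp add: trivial_limit_def)
qed

section \<open>Locality of differentiability, and scalar difference quotients\<close>

lemma has_partial_derivative_cong:
  assumes "open \<Omega>" "x \<in> \<Omega>" "\<And>y. y \<in> \<Omega> \<Longrightarrow> f y = g y"
  shows "has_partial_derivative smul f i l x \<longleftrightarrow> has_partial_derivative smul g i l x"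
proof -
  have "((\<lambda>h::real. x + h *\<^sub>R axis i 1) \<longlongrightarrow> x + 0 *\<^sub>R axis i 1) (at 0)"
    by (intro tendsto_intros)
  then have "\<forall>\<^sub>F h in at (0::real). x + h *\<^sub>R axis i 1 \<in> \<Omega>"
    using assms(1,2) topological_tendstoD by fastforce
  then show ?thesis
    unfolding has_partial_derivative_def
    by (intro tendsto_cong) (auto elim!: eventually_mono simp: assms)
qed

lemma Ck_on_cong:
  assumes "open \<Omega>" "\<And>y. y \<in> \<Omega> \<Longrightarrow> f y = g y"
  shows "Ck_on smul k \<Omega> f \<longleftrightarrow> Ck_on smul k \<Omega> g"
proof -
  have "continuous_on \<Omega> f \<longleftrightarrow> continuous_on \<Omega> g"
    using assms(2) by (intro continuous_on_cong) auto
  moreover have "has_partial_derivative smul f i l x \<longleftrightarrow> has_partial_derivative smul g i l x"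
    if "x \<in> \<Omega>" for i l x
    using assms that by (intro has_partial_derivative_cong)
  \<comment> \<open>Both functions admit the same derivative \<open>g\<close>, so only the top level
    of the recursion changes and no induction is required.\<close>
  ultimately show ?thesis by (cases k) auto
qed

lemma Ck_on_imp_continuous_on: "Ck_on smul k \<Omega> f \<Longrightarrow> continuous_on \<Omega> f"
  by (cases k) auto

text \<open>Near 0 the quotients are close to \<open>l\<close>; for larger steps compactness bounds
  the numerator, and the step is at least \<open>\<eta>\<close>. Only \<open>\<eta>\<close> and
  \<open>M\<close> depend on how \<open>f\<close> behaves, so the same \<open>\<delta>\<close> can
  later serve for all functions \<open>\<phi> \<circ> f\<close> at once.\<close>

lemma bounded_difference_quotients:
  fixes f :: "real ^ 'd \<Rightarrow> 'k::real_normed_field"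
  assumes "has_partial_derivative (*) f i l x" "continuous_on (cball x \<delta>) f"
  shows "bounded ((\<lambda>h. of_real (1 / h) * (f (x + h *\<^sub>R axis i 1) - f x)) ` (cball 0 \<delta> - {0}))"
proof -
  define q where "q = (\<lambda>h::real. of_real (1 / h) * (f (x + h *\<^sub>R axis i 1) - f x))"
  have "\<forall>\<^sub>F h in at 0. dist (q h) l < 1"
    using assms(1) by (intro tendstoD) (auto simp: q_def has_partial_derivative_def)
  then obtain \<eta> where \<eta>: "\<eta> > 0" "\<And>h. h \<noteq> 0 \<Longrightarrow> \<bar>h\<bar> < \<eta> \<Longrightarrow> dist (q h) l < 1"
    by (auto simp: eventually_at)
  have "bounded (f ` cball x \<delta>)"
    using assms(2) by (intro compact_imp_bounded compact_continuous_image) auto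
  then obtain M where M: "M > 0" "\<And>y. y \<in> cball x \<delta> \<Longrightarrow> norm (f y) \<le> M"
    by (auto simp: bounded_pos)
  have "norm (q h) \<le> max (norm l + 1) (2 * M / \<eta>)" if h: "\<bar>h\<bar> \<le> \<delta>" "h \<noteq> 0" for h
  proof (cases "\<bar>h\<bar> < \<eta>")
    case True
    then have "norm (q h - l) < 1" using \<eta>(2) h(2) by (simp add: dist_norm)
    then show ?thesis using norm_triangle_ineq2[of "q h" l] by linarith
  next
    case False
    have "norm (f (x + h *\<^sub>R axis i 1) - f x) \<le> norm (f (x + h *\<^sub>R axis i 1)) + norm (f x)"
      by (rule norm_triangle_ineq4)
    \<comment> \<open>The existence of a step with \<open>\<bar>h\<bar> \<le> \<delta>\<close>
      forces \<open>\<delta> \<ge> 0\<close>, so the centre \<open>x\<close> lies in the ball as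
      well.\<close>
    also have "\<dots> \<le> 2 * M"
      using M(2)[of "x + h *\<^sub>R axis i 1"] M(2)[of x] h abs_ge_zero[of h]
      by (simp add: dist_norm norm_axis_1)
    finally have "norm (q h) \<le> 2 * M / \<bar>h\<bar>"
      by (simp add: q_def norm_mult norm_divide divide_right_mono)
    also have "\<dots> \<le> 2 * M / \<eta>"
      using False \<eta>(1) M(1) by (intro divide_left_mono) auto
    finally show ?thesis by linarith
  qed
  then show ?thesis
    unfolding bounded_iff q_def[symmetric]
    by (intro exI[of _ "max (norm l + 1) (2 * M / \<eta>)"]) (auto simp del: max.bounded_iff)
qed

section \<open>Separation of points and convergence tested by \<open>G\<close>\<close>

locale semi_Montel_determining = semi_Montel_space smul
  for smul :: "'k::real_or_complex \<Rightarrow> 'e::{topological_ab_group_add, t2_space} \<Rightarrow> 'e" +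
  fixes G :: "('e \<Rightarrow> 'k) set"
  assumes G_dual: "G \<subseteq> topological_dual smul"
    and G_bounded: "determines_boundedness smul G"
begin

lemma
  assumes "\<phi> \<in> G"
  shows G_diff: "\<phi> (x - y) = \<phi> x - \<phi> y"
    and G_scale: "\<phi> (smul c x) = c * \<phi> x"
    and G_cont: "continuous_on UNIV \<phi>"
proof -
  have "module_hom smul (*) \<phi>"
    using assms G_dual by (intro topological_dual_module_hom) auto
  then show "\<phi> (x - y) = \<phi> x - \<phi> y" "\<phi> (smul c x) = c * \<phi> x"
    by (rule module_hom.diff, rule module_hom.scale)
  show "continuous_on UNIV \<phi>"
    using assms G_dual by (auto simp: topological_dual_def)
qed

text \<open>Turns the hypothesis on \<open>G\<close> into a test of one functional at a
  time.\<close>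

lemma vector_bounded_if_G_bounded:
  "(\<And>\<phi>. \<phi> \<in> G \<Longrightarrow> bounded (\<phi> ` B)) \<Longrightarrow> vector_bounded smul euclidean B"
  using G_bounded vector_bounded_weak_topologyI[OF vector_space_axioms G_dual]
  by (auto simp: determines_boundedness_def)

lemma G_separates:
  assumes "\<And>\<phi>. \<phi> \<in> G \<Longrightarrow> \<phi> x = \<phi> y"
  shows "x = y"
proof (rule ccontr)
  assume "x \<noteq> y"
  then obtain U where U: "open U" "0 \<in> U" "x - y \<notin> U"
    using t1_space[of 0 "x - y"] by auto
  have "vector_bounded smul euclidean (range (\<lambda>c. smul c (x - y)))"
  proof (rule vector_bounded_if_G_bounded)
    fix \<phi> assume "\<phi> \<in> G"
    then have "\<phi> (smul c (x - y)) = 0" for c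
      by (simp add: G_diff[of \<phi>] G_scale[of \<phi>] assms[of \<phi>])
    then show "bounded (\<phi> ` range (\<lambda>c. smul c (x - y)))" by (simp add: image_image)
  qed
  then obtain r where r: "r > 0" "\<And>c. r \<le> norm c \<Longrightarrow> range (\<lambda>c. smul c (x - y)) \<subseteq> smul c ` U"
    using U unfolding vector_bounded_def by auto
  \<comment> \<open>Absorption is used for the single scalar \<open>r\<close>: cancelling it on both
    sides puts \<open>x - y\<close> into \<open>U\<close>, against the choice of
    \<open>U\<close>.\<close>
  then have "smul (of_real r) (x - y) \<in> smul (of_real r) ` U"
    using r(1) r(2)[of "of_real r"] by (auto simp: image_subset_iff)
  then obtain u where "u \<in> U" "smul (of_real r) (x - y) = smul (of_real r) u" by auto
  then have "x - y = u"
    using r(1) scale_left_imp_eq[of "of_real r" "x - y" u] by simp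
  with \<open>u \<in> U\<close> U show False by simp
qed

text \<open>The scalar limits \<open>m \<phi>\<close> are carried along because they identify the
  limit: as the value \<open>f x\<close> in the proof of continuity, and as a vector lying over the
  scalar derivatives in the induction.\<close>

lemma convergent_if_G_convergent:
  assumes "F \<noteq> bot" "\<forall>\<^sub>F h in F. q h \<in> B"
    and bdd: "\<And>\<phi>. \<phi> \<in> G \<Longrightarrow> bounded (\<phi> ` B)"
    and lim: "\<And>\<phi>. \<phi> \<in> G \<Longrightarrow> ((\<lambda>h. \<phi> (q h)) \<longlongrightarrow> m \<phi>) F"
  obtains l where "(q \<longlongrightarrow> l) F" "\<And>\<phi>. \<phi> \<in> G \<Longrightarrow> \<phi> l = m \<phi>"
proof -
  have K: "compact (closure B)"
    using vector_bounded_if_G_bounded[OF bdd] by (rule bounded_relatively_compact)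
  have ev: "\<forall>\<^sub>F h in F. q h \<in> closure B"
    using assms(2) by eventually_elim (use closure_subset in auto)
  \<comment> \<open>On the infimum of the two filters \<open>\<phi>\<close> tends to
    \<open>\<phi> l\<close> by continuity and to \<open>m \<phi>\<close> by assumption; this filter
    is proper, so the limits agree.\<close>
  have cluster: "\<phi> l = m \<phi>" if "inf (nhds l) (filtermap q F) \<noteq> bot" "\<phi> \<in> G" for l \<phi>
  proof (rule tendsto_unique[OF that(1)])
    have "(\<phi> \<longlongrightarrow> \<phi> l) (nhds l)"
      using G_cont[OF that(2)] by (simp add: continuous_on_def tendsto_at_iff_tendsto_nhds)
    then show "(\<phi> \<longlongrightarrow> \<phi> l) (inf (nhds l) (filtermap q F))"
      by (rule tendsto_mono[rotated]) simp
    have "(\<phi> \<longlongrightarrow> m \<phi>) (filtermap q F)"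
      using lim[OF that(2)] by (simp add: filterlim_filtermap)
    then show "(\<phi> \<longlongrightarrow> m \<phi>) (inf (nhds l) (filtermap q F))"
      by (rule tendsto_mono[rotated]) simp
  qed
  have "filtermap q F \<noteq> bot" using assms(1) by (simp add: filtermap_bot_iff)
  moreover have "\<forall>\<^sub>F y in filtermap q F. y \<in> closure B" using ev by (simp add: eventually_filtermap)
  \<comment> \<open>Compactness supplies one cluster point; \<open>cluster\<close> and
    \<open>G_separates\<close> leave no room for a second.\<close>
  ultimately obtain l where l: "inf (nhds l) (filtermap q F) \<noteq> bot"
    using K unfolding compact_filter by blast
  have "(q \<longlongrightarrow> l) F"
    using K ev
  proof (rule convergent_if_unique_cluster_point)
    fix l' assume "inf (nhds l') (filtermap q F) \<noteq> bot"
    then have "\<phi> l' = \<phi> l" if "\<phi> \<in> G" for \<phi>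
      using cluster[OF _ that] l by metis
    then show "l' = l" by (rule G_separates)
  qed
  then show thesis using cluster[OF l] by (rule that)
qed

section \<open>From regularity under \<open>G\<close> to regularity in \<open>E\<close>\<close>

lemma continuous_on_if_G_continuous_on:
  fixes f :: "real ^ 'd \<Rightarrow> 'e"
  assumes "open \<Omega>" and cont: "\<And>\<phi>. \<phi> \<in> G \<Longrightarrow> continuous_on \<Omega> (\<phi> \<circ> f)"
  shows "continuous_on \<Omega> f"
proof -
  have "isCont f x" if "x \<in> \<Omega>" for x
  proof -
    obtain \<delta> where \<delta>: "\<delta> > 0" "cball x \<delta> \<subseteq> \<Omega>"
      using assms(1) \<open>x \<in> \<Omega>\<close> open_contains_cball by blast
    \<comment> \<open>The compact ball is fixed before any \<open>\<phi>\<close>, so every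
      \<open>\<phi> \<circ> f\<close> is bounded on the same set.\<close>
    obtain l where l: "(f \<longlongrightarrow> l) (at x)" "\<And>\<phi>. \<phi> \<in> G \<Longrightarrow> \<phi> l = \<phi> (f x)"
    proof (rule convergent_if_G_convergent[where F = "at x" and q = f and B = "f ` cball x \<delta>"
            and m = "\<lambda>\<phi>. \<phi> (f x)"])
      show "\<forall>\<^sub>F h in at x. f h \<in> f ` cball x \<delta>"
        using \<delta>(1) by (auto simp: eventually_at dist_commute intro!: exI[of _ \<delta>])
      show "bounded (\<phi> ` f ` cball x \<delta>)" if "\<phi> \<in> G" for \<phi>
      proof -
        have "compact ((\<phi> \<circ> f) ` cball x \<delta>)"
          using cont[OF that] \<delta>(2) by (intro compact_continuous_image) (auto intro: continuous_on_subset)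
        then show ?thesis by (auto simp: image_comp dest: compact_imp_bounded)
      qed
      show "((\<lambda>h. \<phi> (f h)) \<longlongrightarrow> \<phi> (f x)) (at x)" if "\<phi> \<in> G" for \<phi>
        using cont[OF that] assms(1) \<open>x \<in> \<Omega>\<close>
        by (auto simp: continuous_on_eq_continuous_at isCont_def o_def)
    qed auto
    \<comment> \<open>The filter \<open>at x\<close> ignores the value at \<open>x\<close>, so the
      limit still has to be matched with \<open>f x\<close>.\<close>
    then have "l = f x" by (intro G_separates)
    with l show ?thesis by (simp add: isCont_def)
  qed
  then show ?thesis by (auto intro: continuous_at_imp_continuous_on)
qed

text \<open>Functionals in \<open>G\<close> commute with difference quotients by linearity. The
  second conclusion prepares the induction on the order: it ties the vector derivative to the given
  scalar ones.\<close>

lemma has_partial_derivative_if_G: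
  fixes f :: "real ^ 'd \<Rightarrow> 'e"
  assumes "open \<Omega>" "x \<in> \<Omega>"
    and cont: "\<And>\<phi>. \<phi> \<in> G \<Longrightarrow> continuous_on \<Omega> (\<phi> \<circ> f)"
    and deriv: "\<And>\<phi>. \<phi> \<in> G \<Longrightarrow> has_partial_derivative (*) (\<phi> \<circ> f) i (m \<phi>) x"
  obtains l where "has_partial_derivative smul f i l x" "\<And>\<phi>. \<phi> \<in> G \<Longrightarrow> \<phi> l = m \<phi>"
proof -
  obtain \<delta> where \<delta>: "\<delta> > 0" "cball x \<delta> \<subseteq> \<Omega>"
    using assms(1) \<open>x \<in> \<Omega>\<close> open_contains_cball by blast
  define q where "q = (\<lambda>h::real. smul (of_real (1 / h)) (f (x + h *\<^sub>R axis i 1) - f x))"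
  have \<phi>q: "\<phi> (q h) = of_real (1 / h) * ((\<phi> \<circ> f) (x + h *\<^sub>R axis i 1) - (\<phi> \<circ> f) x)" if "\<phi> \<in> G" for \<phi> h
    by (simp add: q_def G_diff[OF that] G_scale[OF that])
  show thesis
  proof (rule convergent_if_G_convergent[where F = "at (0::real)" and q = q
          and B = "q ` (cball 0 \<delta> - {0})" and m = m])
    show "\<forall>\<^sub>F h in at 0. q h \<in> q ` (cball 0 \<delta> - {0})"
      using \<delta>(1) by (auto simp: eventually_at dist_commute intro!: exI[of _ \<delta>])
    show "bounded (\<phi> ` q ` (cball 0 \<delta> - {0}))" if "\<phi> \<in> G" for \<phi>
      unfolding image_image \<phi>q[OF that]
      by (intro bounded_difference_quotients[OF deriv[OF that]] continuous_on_subset[OF cont[OF that]] \<delta>)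
    show "((\<lambda>h. \<phi> (q h)) \<longlongrightarrow> m \<phi>) (at 0)" if "\<phi> \<in> G" for \<phi>
      unfolding \<phi>q[OF that] using deriv[OF that] by (simp only: has_partial_derivative_def)
  qed (use that in \<open>auto simp: has_partial_derivative_def q_def\<close>)
qed

text \<open>The induction generalises \<open>f\<close>, since its hypothesis is applied to a partial
  derivative \<open>g\<close> of \<open>f\<close>; on \<open>\<Omega>\<close> the functions
  \<open>\<phi> \<circ> g\<close> are the scalar derivatives, which have order \<open>k\<close> by
  assumption.\<close>

lemma Ck_on_if_G_Ck_on:
  fixes f :: "real ^ 'd \<Rightarrow> 'e"
  assumes "open \<Omega>" "\<And>\<phi>. \<phi> \<in> G \<Longrightarrow> Ck_on (*) k \<Omega> (\<phi> \<circ> f)"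
  shows "Ck_on smul k \<Omega> f"
  using assms(2)
proof (induction k arbitrary: f)
  case 0
  then show ?case using continuous_on_if_G_continuous_on[OF assms(1)] by simp
next
  case (Suc k)
  have cont: "continuous_on \<Omega> (\<phi> \<circ> f)" if "\<phi> \<in> G" for \<phi>
    using Suc.prems[OF that] by (rule Ck_on_imp_continuous_on)
  have "\<exists>g. (\<forall>x\<in>\<Omega>. has_partial_derivative smul f i (g x) x) \<and> Ck_on smul k \<Omega> g" for i
  proof -
    have "\<forall>\<phi>. \<exists>D. \<phi> \<in> G \<longrightarrow>
        (\<forall>x\<in>\<Omega>. has_partial_derivative (*) (\<phi> \<circ> f) i (D x) x) \<and> Ck_on (*) k \<Omega> D"
      using Suc.prems by (metis Ck_on.simps(2))
    then obtain D where D: "\<And>\<phi> x. \<phi> \<in> G \<Longrightarrow> x \<in> \<Omega> \<Longrightarrow> has_partial_derivative (*) (\<phi> \<circ> f) i (D \<phi> x) x"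
        "\<And>\<phi>. \<phi> \<in> G \<Longrightarrow> Ck_on (*) k \<Omega> (D \<phi>)"
      by metis
    \<comment> \<open>The vector \<open>l\<close> is chosen before \<open>\<phi>\<close>: one
      derivative lies over all the scalar ones, so choice over \<open>x\<close> yields a single
      \<open>g\<close>.\<close>
    have "\<forall>x\<in>\<Omega>. \<exists>l. has_partial_derivative smul f i l x \<and> (\<forall>\<phi>\<in>G. \<phi> l = D \<phi> x)"
      using has_partial_derivative_if_G[OF assms(1) _ cont D(1)] by metis
    then obtain g where g: "\<And>x. x \<in> \<Omega> \<Longrightarrow> has_partial_derivative smul f i (g x) x"
        "\<And>x \<phi>. x \<in> \<Omega> \<Longrightarrow> \<phi> \<in> G \<Longrightarrow> \<phi> (g x) = D \<phi> x"
      by metis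
    have "Ck_on (*) k \<Omega> (\<phi> \<circ> g)" if "\<phi> \<in> G" for \<phi>
      \<comment> \<open>\<open>\<phi> \<circ> g\<close> and \<open>D \<phi>\<close> are known to
        agree on \<open>\<Omega>\<close> only, hence the detour through congruence.\<close>
      by (rule Ck_on_cong[OF assms(1), THEN iffD2, OF _ D(2)[OF that]]) (simp add: g(2)[OF _ that])
    then show ?thesis using Suc.IH g(1) by blast
  qed
  then show ?case
    using continuous_on_if_G_continuous_on[OF assms(1) cont] by simp
qed

end

theorem theorem5p3p6:
  fixes smul :: "'k::real_or_complex \<Rightarrow> 'e::{topological_ab_group_add, t2_space} \<Rightarrow> 'e"
    and G :: "('e \<Rightarrow> 'k) set"
    and \<Omega> :: "(real ^ 'd) set"
    and f :: "real ^ 'd \<Rightarrow> 'e"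
    and k :: nat
  assumes "semi_Montel_space smul"
    and "linear_subspace_of G (topological_dual smul)"
    and "determines_boundedness smul G"
    and "open \<Omega>"
    and "\<And>\<phi>. \<phi> \<in> G \<Longrightarrow> Ck_on (*) k \<Omega> (\<phi> \<circ> f)"
  shows "Ck_on smul k \<Omega> f"
proof -
  interpret semi_Montel_determining smul G
    using assms(1-3)
    by (simp add: semi_Montel_determining_def semi_Montel_determining_axioms_def linear_subspace_of_def)
  show ?thesis using assms(4,5) by (rule Ck_on_if_G_Ck_on)
qed

end
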